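(* Let $m > 1$ be an integer. The lower central series of the group $$G = BS(m,m+1) = \langle\, a, t \mid t^{-1} a^m t = a^{m+1} \,\rangle$$ has length $2$.
   Context: For a group $G$, the lower central series is defined by $\gamma_1 G = G$ and $\gamma_{i+1} G = [\gamma_i G, G]$ for $i \geq 1$, where $[A,B]$ denotes the subgroup generated by all commutators $[x,y] = x^{-1}y^{-1}xy$ with $x \in A$, $y \in B$. The length of the lower central series of $G$ is the minimal number $N$ for which $\gamma_N G = \gamma_{N+1} G$. *)

theory Defs
  imports "HOL-Algebra.Coset" "HOL-Algebra.Generated_Groups"
begin

section \<open>Free groups\<close>

text \<open>
  A letter \<open>(x, True)\<close> stands for the generator \<open>x\<close> and \<open>(x, False)\<close> for its formal inverse.
  Elements of the free group are classes of words modulo insertion and deletion of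
  cancelling pairs.
\<close>

type_synonym 'x word = "('x \<times> bool) list"

inductive_set free_eq :: "'x set \<Rightarrow> ('x word \<times> 'x word) set"
  for S :: "'x set"
  where
    refl: "u \<in> lists (S \<times> UNIV) \<Longrightarrow> (u, u) \<in> free_eq S"
  | sym: "(u, v) \<in> free_eq S \<Longrightarrow> (v, u) \<in> free_eq S"
  | trans: "(u, v) \<in> free_eq S \<Longrightarrow> (v, w) \<in> free_eq S \<Longrightarrow> (u, w) \<in> free_eq S"
  | cancel: "u \<in> lists (S \<times> UNIV) \<Longrightarrow> v \<in> lists (S \<times> UNIV) \<Longrightarrow> x \<in> S
      \<Longrightarrow> (u @ [(x, b), (x, \<not> b)] @ v, u @ v) \<in> free_eq S"

definition free_group :: "'x set \<Rightarrow> 'x word set monoid" where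
  "free_group S =
    \<lparr>carrier = lists (S \<times> UNIV) // free_eq S,
     mult = (\<lambda>A B. \<Union>u\<in>A. \<Union>v\<in>B. free_eq S `` {u @ v}),
     one = free_eq S `` {[]}\<rparr>"

definition free_gen :: "'x set \<Rightarrow> 'x \<Rightarrow> 'x word set" where
  "free_gen S x = free_eq S `` {[(x, True)]}"

lemma free_eq_lists:
  "(u, v) \<in> free_eq S \<Longrightarrow> u \<in> lists (S \<times> UNIV) \<and> v \<in> lists (S \<times> UNIV)"
  by (induction rule: free_eq.induct) auto

lemma equiv_free_eq: "equiv (lists (S \<times> UNIV)) (free_eq S)"
proof (rule equivI)
  show "free_eq S \<subseteq> lists (S \<times> UNIV) \<times> lists (S \<times> UNIV)"
    by (auto dest: free_eq_lists)
  show "refl_on (lists (S \<times> UNIV)) (free_eq S)"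
    by (auto intro!: refl_onI free_eq.refl)
  show "sym (free_eq S)"
    by (auto intro: symI free_eq.sym)
  show "trans (free_eq S)"
    by (meson transI free_eq.trans)
qed

lemma free_eq_append_left:
  "(u, v) \<in> free_eq S \<Longrightarrow> w \<in> lists (S \<times> UNIV) \<Longrightarrow> (w @ u, w @ v) \<in> free_eq S"
proof (induction rule: free_eq.induct)
  case (cancel u v x b)
  then show ?case
    using free_eq.cancel[of "w @ u" S v x b] by auto
next
  case (refl u)
  then show ?case by (intro free_eq.refl) simp
qed (blast intro: free_eq.sym free_eq.trans)+

lemma free_eq_append_right:
  "(u, v) \<in> free_eq S \<Longrightarrow> w \<in> lists (S \<times> UNIV) \<Longrightarrow> (u @ w, v @ w) \<in> free_eq S"
proof (induction rule: free_eq.induct)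
  case (cancel u v x b)
  then show ?case
    using free_eq.cancel[of u S "v @ w" x b] by auto
next
  case (refl u)
  then show ?case by (intro free_eq.refl) simp
qed (blast intro: free_eq.sym free_eq.trans)+

lemma free_eq_append:
  "(u, u') \<in> free_eq S \<Longrightarrow> (v, v') \<in> free_eq S \<Longrightarrow> (u @ v, u' @ v') \<in> free_eq S"
  by (meson free_eq_append_left free_eq_append_right free_eq_lists free_eq.trans)

lemma free_group_mult_class:
  assumes "u \<in> lists (S \<times> UNIV)" "v \<in> lists (S \<times> UNIV)"
  shows "(free_eq S `` {u}) \<otimes>\<^bsub>free_group S\<^esub> (free_eq S `` {v}) = free_eq S `` {u @ v}"
proof -
  have "congruent2 (free_eq S) (free_eq S) (\<lambda>u v. free_eq S `` {u @ v})"
    by (auto simp: congruent2_def intro!: equiv_class_eq[OF equiv_free_eq] free_eq_append)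
  from UN_equiv_class2[OF equiv_free_eq equiv_free_eq this assms]
  show ?thesis by (simp add: free_group_def)
qed

lemma free_eq_inverse:
  "u \<in> lists (S \<times> UNIV) \<Longrightarrow> (rev (map (apsnd Not) u) @ u, []) \<in> free_eq S"
proof (induction u)
  case Nil
  then show ?case by (simp add: free_eq.refl)
next
  case (Cons p u)
  obtain x b where p: "p = (x, b)" by force
  have x: "x \<in> S" and u: "u \<in> lists (S \<times> UNIV)"
    using Cons.prems p by auto
  have "rev (map (apsnd Not) u) \<in> lists (S \<times> UNIV)"
    using u by (fastforce simp: lists_eq_set)
  from free_eq.cancel[OF this u x, of "\<not> b"]
  have "(rev (map (apsnd Not) (p # u)) @ p # u, rev (map (apsnd Not) u) @ u) \<in> free_eq S"
    by (simp add: p)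
  with Cons.IH[OF u] show ?case
    by (blast intro: free_eq.trans)
qed

lemma group_free_group: "group (free_group S)"
proof -
  let ?W = "lists (S \<times> UNIV) :: 'a word set"
  have carrier: "carrier (free_group S) = ?W // free_eq S"
    and one: "\<one>\<^bsub>free_group S\<^esub> = free_eq S `` {[]}"
    by (simp_all add: free_group_def)
  show ?thesis
  proof (rule groupI)
    fix A B assume "A \<in> carrier (free_group S)" "B \<in> carrier (free_group S)"
    then show "A \<otimes>\<^bsub>free_group S\<^esub> B \<in> carrier (free_group S)"
      unfolding carrier
      by (elim quotientE) (simp add: free_group_mult_class quotientI)
  next
    show "\<one>\<^bsub>free_group S\<^esub> \<in> carrier (free_group S)"
      unfolding carrier one by (auto intro: quotientI)
  next
    fix A B C
    assume "A \<in> carrier (free_group S)" "B \<in> carrier (free_group S)" "C \<in> carrier (free_group S)"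
    then show "A \<otimes>\<^bsub>free_group S\<^esub> B \<otimes>\<^bsub>free_group S\<^esub> C
        = A \<otimes>\<^bsub>free_group S\<^esub> (B \<otimes>\<^bsub>free_group S\<^esub> C)"
      unfolding carrier by (elim quotientE) (simp add: free_group_mult_class)
  next
    fix A assume "A \<in> carrier (free_group S)"
    then show "\<one>\<^bsub>free_group S\<^esub> \<otimes>\<^bsub>free_group S\<^esub> A = A"
      unfolding carrier one by (elim quotientE) (simp add: free_group_mult_class)
  next
    fix A assume "A \<in> carrier (free_group S)"
    then obtain u where u: "u \<in> ?W" "A = free_eq S `` {u}"
      unfolding carrier quotient_def by blast
    let ?v = "rev (map (apsnd Not) u)"
    have v: "?v \<in> ?W" using u(1) by (fastforce simp: lists_eq_set)
    have "free_eq S `` {?v} \<otimes>\<^bsub>free_group S\<^esub> A = \<one>\<^bsub>free_group S\<^esub>"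
      unfolding one u(2) free_group_mult_class[OF v u(1)]
      by (rule equiv_class_eq[OF equiv_free_eq free_eq_inverse[OF u(1)]])
    moreover have "free_eq S `` {?v} \<in> carrier (free_group S)"
      unfolding carrier by (rule quotientI[OF v])
    ultimately show "\<exists>B\<in>carrier (free_group S). B \<otimes>\<^bsub>free_group S\<^esub> A = \<one>\<^bsub>free_group S\<^esub>"
      by blast
  qed
qed

section \<open>Presentations\<close>

definition normal_closure :: "('a, 'b) monoid_scheme \<Rightarrow> 'a set \<Rightarrow> 'a set" where
  "normal_closure G R = \<Inter>{N. N \<lhd> G \<and> R \<subseteq> N}"

lemma (in group) normal_normal_closure:
  assumes "R \<subseteq> carrier G"
  shows "normal_closure G R \<lhd> G"
proof -
  let ?\<N> = "{N. N \<lhd> G \<and> R \<subseteq> N}"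
  have "carrier G \<lhd> G"
    by (rule normal_invI) (auto intro: subgroup_self)
  with assms have ne: "?\<N> \<noteq> {}" by blast
  have "subgroup (\<Inter>?\<N>) G"
    by (rule subgroups_Inter[OF _ ne]) (auto intro: normal_imp_subgroup)
  then show ?thesis
    unfolding normal_closure_def
    by (rule normal_invI) (auto dest: normal_invE(2))
qed

text \<open>A pair \<open>(u, v)\<close> of elements of the free group encodes the defining relation \<open>u = v\<close>.\<close>

definition presented_group :: "'x set \<Rightarrow> ('x word set \<times> 'x word set) set \<Rightarrow> 'x word set set monoid"
  where
  "presented_group S E =
    free_group S Mod
      normal_closure (free_group S)
        {u \<otimes>\<^bsub>free_group S\<^esub> inv\<^bsub>free_group S\<^esub> v | u v. (u, v) \<in> E}"

lemma group_presented_group: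
  assumes "E \<subseteq> carrier (free_group S) \<times> carrier (free_group S)"
  shows "group (presented_group S E)"
proof -
  interpret F: group "free_group S" by (rule group_free_group)
  show ?thesis
    unfolding presented_group_def
    using assms by (intro normal.factorgroup_is_group F.normal_normal_closure) auto
qed

lemma free_gen_closed: "x \<in> S \<Longrightarrow> free_gen S x \<in> carrier (free_group S)"
  by (auto simp: free_gen_def free_group_def intro!: quotientI)

datatype bs_gen = Gen_a | Gen_t

definition BS :: "int \<Rightarrow> int \<Rightarrow> bs_gen word set set monoid" where
  "BS m n =
    (let F = free_group {Gen_a, Gen_t};
         a = free_gen {Gen_a, Gen_t} Gen_a;
         t = free_gen {Gen_a, Gen_t} Gen_t
     in presented_group {Gen_a, Gen_t}
          {(inv\<^bsub>F\<^esub> t \<otimes>\<^bsub>F\<^esub> a [^]\<^bsub>F\<^esub> m \<otimes>\<^bsub>F\<^esub> t, a [^]\<^bsub>F\<^esub> n)})"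

lemma group_BS: "group (BS m n)"
proof -
  interpret F: group "free_group {Gen_a, Gen_t}" by (rule group_free_group)
  show ?thesis
    unfolding BS_def Let_def
    by (intro group_presented_group) (simp add: free_gen_closed)
qed

section \<open>Lower central series\<close>

definition commutator_subgroup :: "('a, 'b) monoid_scheme \<Rightarrow> 'a set \<Rightarrow> 'a set \<Rightarrow> 'a set" where
  "commutator_subgroup G A B =
    generate G {inv\<^bsub>G\<^esub> x \<otimes>\<^bsub>G\<^esub> inv\<^bsub>G\<^esub> y \<otimes>\<^bsub>G\<^esub> x \<otimes>\<^bsub>G\<^esub> y | x y. x \<in> A \<and> y \<in> B}"

text \<open>The series is indexed from 1; the value at 0 is a dummy.\<close>

fun lower_central :: "('a, 'b) monoid_scheme \<Rightarrow> nat \<Rightarrow> 'a set" where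
  "lower_central G 0 = carrier G"
| "lower_central G (Suc 0) = carrier G"
| "lower_central G (Suc (Suc i)) =
    commutator_subgroup G (lower_central G (Suc i)) (carrier G)"

text \<open>
  A relation rather than a function, since the series need not stabilise at a finite stage.
  Only indices \<open>N \<ge> 1\<close> count.
\<close>

definition lower_central_length :: "('a, 'b) monoid_scheme \<Rightarrow> nat \<Rightarrow> bool" where
  "lower_central_length G N \<longleftrightarrow>
    1 \<le> N \<and> lower_central G N = lower_central G (N + 1) \<and>
    (\<forall>M. 1 \<le> M \<and> lower_central G M = lower_central G (M + 1) \<longrightarrow> N \<le> M)"

end

theory Submission
  imports Defs "HOL-Algebra.Elementary_Groups"
begin

text \<open>
  The defining relation says that \<open>a = [a\<^sup>m, t]\<close>. Hence \<open>a \<in> \<gamma>\<^sub>2\<close>, so \<open>a\<^sup>m \<in> \<gamma>\<^sub>2\<close>, and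
  therefore \<open>a \<in> \<gamma>\<^sub>3\<close>. The quotient by \<open>\<gamma>\<^sub>3\<close> is then generated by the image of \<open>t\<close>, so it is
  abelian and \<open>\<gamma>\<^sub>2 \<subseteq> \<gamma>\<^sub>3\<close>. On the other hand \<open>a \<mapsto> 0\<close>, \<open>t \<mapsto> 1\<close> defines a nontrivial
  homomorphism to the integers, so \<open>\<gamma>\<^sub>1 \<noteq> \<gamma>\<^sub>2\<close>.
\<close>

section \<open>Homomorphisms from presented groups\<close>

lemma carrier_free_group: "carrier (free_group S) = (\<lambda>u. free_eq S `` {u}) ` lists (S \<times> UNIV)"
  by (auto simp: free_group_def quotient_def)

lemma inv_free_gen:
  assumes "x \<in> S"
  shows "inv\<^bsub>free_group S\<^esub> free_gen S x = free_eq S `` {[(x, False)]}"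
proof -
  interpret F: group "free_group S" by (rule group_free_group)
  have "free_eq S `` {[(x, False)]} \<otimes>\<^bsub>free_group S\<^esub> free_gen S x = \<one>\<^bsub>free_group S\<^esub>"
    using assms free_eq_inverse[of "[(x, True)]" S]
    by (simp add: free_gen_def free_group_mult_class)
      (simp add: free_group_def equiv_class_eq[OF equiv_free_eq])
  then show ?thesis
    using assms by (intro F.inv_equality free_gen_closed) (auto simp: carrier_free_group)
qed

text \<open>Induction on a representing word: the class of a single letter is a generator or, by
  \<open>inv_free_gen\<close>, the inverse of one.\<close>

lemma free_group_generated: "carrier (free_group S) = generate (free_group S) (free_gen S ` S)"
proof
  interpret F: group "free_group S" by (rule group_free_group)
  show "generate (free_group S) (free_gen S ` S) \<subseteq> carrier (free_group S)"
    by (rule F.generate_incl) (auto simp: free_gen_closed)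
  have "free_eq S `` {u} \<in> generate (free_group S) (free_gen S ` S)" if "u \<in> lists (S \<times> UNIV)" for u
    using that
  proof (induction u)
    case Nil
    show ?case
      using generate.one[of "free_group S"] by (simp add: free_group_def)
  next
    case (Cons p u)
    obtain x b where p: "p = (x, b)" by force
    have x: "x \<in> S" using Cons.hyps p by simp
    have "free_eq S `` {[p]} \<in> generate (free_group S) (free_gen S ` S)"
    proof (cases b)
      case True
      then show ?thesis
        using x p generate.incl[of "free_gen S x" "free_gen S ` S" "free_group S"]
        by (simp add: free_gen_def)
    next
      case False
      then show ?thesis
        using x p generate.inv[of "free_gen S x" "free_gen S ` S" "free_group S"]
        by (auto simp: inv_free_gen)
    qed
    from generate.eng[OF this Cons.IH] show ?case
      using Cons.hyps by (simp add: free_group_mult_class)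
  qed
  then show "carrier (free_group S) \<subseteq> generate (free_group S) (free_gen S ` S)"
    by (auto simp: carrier_free_group)
qed

section \<open>Evaluation of words and the universal property of free groups\<close>

fun eval_word :: "('a, 'b) monoid_scheme \<Rightarrow> ('x \<Rightarrow> 'a) \<Rightarrow> 'x word \<Rightarrow> 'a" where
  "eval_word G f [] = \<one>\<^bsub>G\<^esub>"
| "eval_word G f ((x, b) # u) = (if b then f x else inv\<^bsub>G\<^esub> f x) \<otimes>\<^bsub>G\<^esub> eval_word G f u"

context group
begin

lemma eval_word_closed:
  "f ` S \<subseteq> carrier G \<Longrightarrow> u \<in> lists (S \<times> UNIV) \<Longrightarrow> eval_word G f u \<in> carrier G"
  by (induction u) auto

lemma eval_word_append:
  assumes "f ` S \<subseteq> carrier G" "u \<in> lists (S \<times> UNIV)" "v \<in> lists (S \<times> UNIV)"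
  shows "eval_word G f (u @ v) = eval_word G f u \<otimes> eval_word G f v"
  using assms(2)
proof (induction u)
  case (Cons p u)
  obtain x b where "p = (x, b)" by force
  moreover have "f x \<in> carrier G" using calculation Cons.hyps assms(1) by auto
  ultimately show ?case
    using Cons assms by (simp add: eval_word_closed[of f S] m_assoc)
qed (simp add: assms eval_word_closed[of f S])

text \<open>This makes evaluation well defined on classes. The only real case is a cancelling pair,
  whose two values are mutually inverse.\<close>

lemma eval_word_free_eq:
  assumes "f ` S \<subseteq> carrier G" "(u, v) \<in> free_eq S"
  shows "eval_word G f u = eval_word G f v"
  using assms(2)
proof (induction rule: free_eq.induct)
  case (cancel u v x b)
  have fx: "f x \<in> carrier G" using assms(1) cancel by auto
  have v: "eval_word G f v \<in> carrier G" using assms(1) cancel by (simp add: eval_word_closed)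
  have "eval_word G f ([(x, b), (x, \<not> b)] @ v) = eval_word G f v"
    using fx v by (cases b) (simp_all flip: m_assoc)
  then show ?case
    using assms(1) cancel by (simp add: eval_word_append del: eval_word.simps)
qed auto

lemma free_group_universal:
  assumes "f ` S \<subseteq> carrier G"
  obtains h where "h \<in> hom (free_group S) G" "\<And>x. x \<in> S \<Longrightarrow> h (free_gen S x) = f x"
proof -
  \<comment> \<open>Evaluation is constant on each class, so the image of a class is a singleton and
    \<open>the_elem\<close> extracts the common value.\<close>
  define h where "h A = the_elem (eval_word G f ` A)" for A
  have h: "h (free_eq S `` {u}) = eval_word G f u" if "u \<in> lists (S \<times> UNIV)" for u
  proof -
    have "u \<in> free_eq S `` {u}"
      using free_eq.refl[OF that] by simp
    moreover have "eval_word G f v = eval_word G f u" if "v \<in> free_eq S `` {u}" for v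
      using that eval_word_free_eq[OF assms, of u v] by simp
    ultimately have "eval_word G f ` (free_eq S `` {u}) = {eval_word G f u}"
      by blast
    then show ?thesis by (simp add: h_def)
  qed
  have "h \<in> hom (free_group S) G"
  proof (rule homI)
    fix A assume "A \<in> carrier (free_group S)"
    then obtain u where u: "u \<in> lists (S \<times> UNIV)" "A = free_eq S `` {u}"
      unfolding carrier_free_group by blast
    then show "h A \<in> carrier G"
      using assms by (simp only: h eval_word_closed)
    fix B assume "B \<in> carrier (free_group S)"
    then obtain v where "v \<in> lists (S \<times> UNIV)" "B = free_eq S `` {v}"
      unfolding carrier_free_group by blast
    with u show "h (A \<otimes>\<^bsub>free_group S\<^esub> B) = h A \<otimes> h B"
      using assms by (simp only: h free_group_mult_class eval_word_append append_in_lists_conv)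
  qed
  moreover have "h (free_gen S x) = f x" if "x \<in> S" for x
    using that assms by (auto simp: free_gen_def h)
  ultimately show ?thesis using that by blast
qed

end

section \<open>Presented groups as quotients of free groups\<close>

locale presentation =
  fixes S :: "'x set" and E :: "('x word set \<times> 'x word set) set"
  assumes relations_closed: "E \<subseteq> carrier (free_group S) \<times> carrier (free_group S)"
begin

definition relators :: "'x word set set" where
  "relators = {u \<otimes>\<^bsub>free_group S\<^esub> inv\<^bsub>free_group S\<^esub> v | u v. (u, v) \<in> E}"

definition proj :: "'x word set \<Rightarrow> 'x word set set" where
  "proj A = normal_closure (free_group S) relators #>\<^bsub>free_group S\<^esub> A"

sublocale F: group "free_group S" by (rule group_free_group)

lemma relators_closed: "relators \<subseteq> carrier (free_group S)"
  using relations_closed by (auto simp: relators_def)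

lemma presented_group_eq:
  "presented_group S E = free_group S Mod normal_closure (free_group S) relators"
  by (simp add: presented_group_def relators_def)

sublocale N: normal "normal_closure (free_group S) relators" "free_group S"
  by (rule F.normal_normal_closure[OF relators_closed])

sublocale P: group "presented_group S E"
  by (rule group_presented_group[OF relations_closed])

sublocale proj: group_hom "free_group S" "presented_group S E" proj
  unfolding group_hom_def group_hom_axioms_def
  using N.r_coset_hom_Mod F.is_group P.is_group
  by (simp add: presented_group_eq proj_def[abs_def])

lemma proj_surj: "proj ` carrier (free_group S) = carrier (presented_group S E)"
  by (simp add: presented_group_eq carrier_FactGroup proj_def[abs_def])

text \<open>The relator belonging to \<open>(u, v)\<close> lies in the normal closure, so
  \<open>u\<close> and \<open>v\<close> have the same coset.\<close>

lemma proj_relation: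
  assumes "(u, v) \<in> E"
  shows "proj u = proj v"
proof -
  have uv: "u \<in> carrier (free_group S)" "v \<in> carrier (free_group S)"
    using assms relations_closed by auto
  have "u \<otimes>\<^bsub>free_group S\<^esub> inv\<^bsub>free_group S\<^esub> v \<in> normal_closure (free_group S) relators"
    using assms by (auto simp: normal_closure_def relators_def)
  then have "u \<in> normal_closure (free_group S) relators #>\<^bsub>free_group S\<^esub> v"
    using uv by (intro N.rcos_module_rev) auto
  then show ?thesis
    unfolding proj_def
    using F.repr_independence uv(2) N.subgroup_axioms by metis
qed

lemma presented_group_generated:
  "carrier (presented_group S E) = generate (presented_group S E) (proj ` free_gen S ` S)"
proof -
  have "free_gen S ` S \<subseteq> carrier (free_group S)" by (auto simp: free_gen_closed)
  from proj.generate_img[OF this] show ?thesis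
    by (simp add: proj_surj flip: free_group_generated)
qed

text \<open>The kernel of \<open>h\<close> is a normal subgroup containing all relators, hence
  contains their normal closure, and \<open>h\<close> factors through the quotient.\<close>

lemma universal:
  assumes "group H" "h \<in> hom (free_group S) H" "\<And>u v. (u, v) \<in> E \<Longrightarrow> h u = h v"
  obtains g where "g \<in> hom (presented_group S E) H"
    "\<And>A. A \<in> carrier (free_group S) \<Longrightarrow> g (proj A) = h A"
proof -
  interpret H: group H by fact
  interpret h: group_hom "free_group S" H h
    by unfold_locales (rule assms)
  have "relators \<subseteq> kernel (free_group S) H h"
    using assms(3) relations_closed by (fastforce simp: relators_def kernel_def)
  then have "normal_closure (free_group S) relators \<subseteq> kernel (free_group S) H h"
    using h.normal_kernel by (auto simp: normal_closure_def)
  from h.FactGroup_universal_kernel[OF N.normal_axioms this] that show ?thesis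
    unfolding presented_group_eq proj_def by blast
qed

end

section \<open>The lower central series\<close>

context group
begin

lemma commutator_subgroup_subset:
  assumes "A \<subseteq> carrier G" "B \<subseteq> carrier G" "N \<lhd> G"
    and "\<And>x y. x \<in> A \<Longrightarrow> y \<in> B \<Longrightarrow> inv x \<otimes> inv y \<otimes> x \<otimes> y \<in> N"
  shows "commutator_subgroup G A B \<subseteq> N"
  unfolding commutator_subgroup_def
  using assms by (intro generate_subgroup_incl normal_imp_subgroup) auto

lemma commutator_subgroup_mono:
  assumes "A \<subseteq> A'"
  shows "commutator_subgroup G A B \<subseteq> commutator_subgroup G A' B"
  unfolding commutator_subgroup_def using assms by (intro mono_generate) blast

lemma commutator_in_commutator_subgroup:
  "x \<in> A \<Longrightarrow> y \<in> B \<Longrightarrow> inv x \<otimes> inv y \<otimes> x \<otimes> y \<in> commutator_subgroup G A B"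
  unfolding commutator_subgroup_def by (blast intro: generate.incl)

lemma conj_mult:
  assumes "g \<in> carrier G" "x \<in> carrier G" "y \<in> carrier G"
  shows "g \<otimes> (x \<otimes> y) \<otimes> inv g = (g \<otimes> x \<otimes> inv g) \<otimes> (g \<otimes> y \<otimes> inv g)"
  using assms by (simp add: m_assoc inv_solve_left)

lemma conj_inv:
  assumes "g \<in> carrier G" "x \<in> carrier G"
  shows "g \<otimes> inv x \<otimes> inv g = inv (g \<otimes> x \<otimes> inv g)"
  using assms by (simp add: inv_mult_group m_assoc)

text \<open>Conjugation by \<open>g\<close> is an automorphism preserving \<open>A\<close> and
  \<open>B\<close>, so it permutes the generating commutators: it sends the one of
  \<open>x, y\<close> to the one of their conjugates.\<close>

lemma normal_commutator_subgroup:
  assumes "A \<lhd> G" "B \<lhd> G"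
  shows "commutator_subgroup G A B \<lhd> G"
  unfolding commutator_subgroup_def
proof (rule normal_generateI)
  interpret A: normal A G by fact
  interpret B: normal B G by fact
  show "{inv x \<otimes> inv y \<otimes> x \<otimes> y | x y. x \<in> A \<and> y \<in> B} \<subseteq> carrier G" by auto
  fix h g
  assume "h \<in> {inv x \<otimes> inv y \<otimes> x \<otimes> y | x y. x \<in> A \<and> y \<in> B}" and g: "g \<in> carrier G"
  then obtain x y where xy: "x \<in> A" "y \<in> B" "h = inv x \<otimes> inv y \<otimes> x \<otimes> y" by blast
  let ?x = "g \<otimes> x \<otimes> inv g" and ?y = "g \<otimes> y \<otimes> inv g"
  have "g \<otimes> h \<otimes> inv g = inv ?x \<otimes> inv ?y \<otimes> ?x \<otimes> ?y"
    using g xy by (simp only: conj_mult conj_inv A.mem_carrier B.mem_carrier inv_closed m_closed)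
  moreover have "?x \<in> A" "?y \<in> B"
    using g xy by (auto intro: A.inv_op_closed2 B.inv_op_closed2)
  ultimately show "g \<otimes> h \<otimes> inv g \<in> {inv x \<otimes> inv y \<otimes> x \<otimes> y | x y. x \<in> A \<and> y \<in> B}"
    by blast
qed

lemma normal_carrier: "carrier G \<lhd> G"
  by (rule normal_invI) (auto intro: subgroup_self)

lemma normal_lower_central: "lower_central G n \<lhd> G"
proof (induction n)
  case (Suc n)
  then show ?case
    by (cases n) (simp_all add: normal_carrier normal_commutator_subgroup)
qed (simp add: normal_carrier)

lemma lower_central_antimono_Suc:
  assumes "1 \<le> n"
  shows "lower_central G (Suc n) \<subseteq> lower_central G n"
  using assms
proof (induction n rule: dec_induct)
  case base
  show ?case
    using normal_imp_subgroup[OF normal_lower_central[of 2]] subgroup.subset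
    by (force simp: numeral_2_eq_2)
next
  case (step n)
  \<comment> \<open>Writing \<open>n\<close> as a successor lets the recursive equation unfold on
    both sides; the inclusion then follows by monotonicity in the first argument.\<close>
  then obtain k where "n = Suc k" by (cases n) auto
  then show ?case
    using step.IH by (simp add: commutator_subgroup_mono)
qed

text \<open>When \<open>a\<close> and \<open>t\<close> generate the group, this says that the
  quotient by \<open>N\<close> is cyclic: \<open>a\<close> becomes trivial there, so only the image
  of \<open>t\<close> remains as a generator.\<close>

lemma rcoset_power_of_generator:
  assumes "N \<lhd> G" "a \<in> N" "t \<in> carrier G" "g \<in> generate G {a, t}"
  shows "\<exists>k::int. N #> g = N #> t [^] k"
proof -
  interpret N: normal N G by fact
  have a: "a \<in> carrier G" using assms by auto
  \<comment> \<open>Elements of \<open>N\<close>, in particular \<open>a\<close> and its inverse,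
    correspond to the exponent 0.\<close>
  have eq_N: "N #> x = N #> t [^] (0::int)" if "x \<in> N" for x
    using that by (simp add: N.rcos_const N.subset)
  show ?thesis
    using assms(4)
  proof (induction rule: generate.induct)
    case one
    show ?case using eq_N[OF N.one_closed] by blast
  next
    case (incl h)
    then show ?case
      using eq_N[OF assms(2)] int_pow_1[OF assms(3)] by (metis empty_iff insert_iff)
  next
    case (inv h)
    then consider "h = a" | "h = t" by auto
    then show ?case
    proof cases
      case 1
      then show ?thesis using eq_N[OF N.m_inv_closed[OF assms(2)]] by blast
    next
      case 2
      then show ?thesis
        using assms(3) by (intro exI[of _ "-1"]) (simp add: int_pow_neg)
    qed
  next
    case (eng h1 h2)
    then obtain k1 k2 :: int where "N #> h1 = N #> t [^] k1" "N #> h2 = N #> t [^] k2" by blast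
    moreover have "h1 \<in> carrier G" "h2 \<in> carrier G"
      using eng.hyps generate_incl[of "{a, t}"] a assms(3) by auto
    ultimately have "N #> (h1 \<otimes> h2) = N #> t [^] (k1 + k2)"
      using assms(3) by (simp add: int_pow_mult flip: N.rcos_sum)
    then show ?case by blast
  qed
qed

text \<open>The quotient by \<open>N\<close> is cyclic, hence abelian, so every commutator falls
  into \<open>N\<close>.\<close>

lemma commutator_subgroup_subset_normal:
  assumes "N \<lhd> G" "a \<in> N" "t \<in> carrier G" "carrier G = generate G {a, t}"
  shows "commutator_subgroup G (carrier G) (carrier G) \<subseteq> N"
proof (rule commutator_subgroup_subset[OF _ _ assms(1)])
  interpret N: normal N G by fact
  fix x y assume xy: "x \<in> carrier G" "y \<in> carrier G"
  then obtain k l :: int where kl: "N #> x = N #> t [^] k" "N #> y = N #> t [^] l"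
    using rcoset_power_of_generator[OF assms(1-3)] assms(4) by metis
  have "N #> (x \<otimes> y) = N #> t [^] (k + l)"
    using xy kl assms(3) by (simp add: int_pow_mult flip: N.rcos_sum)
  also have "\<dots> = N #> (y \<otimes> x)"
    using xy kl assms(3) by (simp add: int_pow_mult add.commute[of k] flip: N.rcos_sum)
  \<comment> \<open>Multiplying equal cosets on the left by \<open>inv (y \<otimes> x)\<close> turns
    \<open>x \<otimes> y\<close> into the commutator of \<open>x\<close> and \<open>y\<close>, and
    \<open>y \<otimes> x\<close> into the identity.\<close>
  finally have "N #> (inv (y \<otimes> x) \<otimes> (x \<otimes> y)) = N #> (inv (y \<otimes> x) \<otimes> (y \<otimes> x))"
    using xy N.rcos_sum[of "inv (y \<otimes> x)"] by (metis inv_closed m_closed)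
  then have "N #> (inv x \<otimes> inv y \<otimes> x \<otimes> y) = N"
    using xy by (simp add: inv_mult_group m_assoc N.subset)
      (simp add: N.subset flip: m_assoc)
  then show "inv x \<otimes> inv y \<otimes> x \<otimes> y \<in> N"
    using xy by (metis N.subgroup_axioms inv_closed m_closed rcos_self)
qed auto

lemma lower_central_2_eq_3:
  fixes m :: int
  assumes a: "a \<in> carrier G" and t: "t \<in> carrier G" and gen: "carrier G = generate G {a, t}"
    and rel: "inv t \<otimes> a [^] m \<otimes> t = a [^] (m + 1)"
  shows "lower_central G 2 = lower_central G 3"
proof
  have numerals: "2 = Suc (Suc 0)" "3 = Suc (Suc (Suc 0))" by simp_all
  \<comment> \<open>By \<open>rel\<close>, the last three factors of the commutator form
    \<open>a [^] (m + 1)\<close>.\<close>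
  have "inv (a [^] m) \<otimes> inv t \<otimes> a [^] m \<otimes> t = inv (a [^] m) \<otimes> a [^] (m + 1)"
    using a t by (simp add: m_assoc flip: rel)
  also have "\<dots> = a"
    using a by (simp add: int_pow_mult flip: m_assoc)
  finally have comm: "inv (a [^] m) \<otimes> inv t \<otimes> a [^] m \<otimes> t = a" .
  have "a \<in> lower_central G 2"
    using commutator_in_commutator_subgroup[of "a [^] m" "carrier G" t "carrier G"] a t comm
    by (simp add: numerals)
  \<comment> \<open>The same commutator identity is used again, now with its first entry in
    \<open>\<gamma>\<^sub>2\<close> rather than merely in the group; this moves \<open>a\<close> one
    term further down.\<close>
  then have "a [^] m \<in> lower_central G 2"
    by (rule subgroup_int_pow_closed[OF normal_imp_subgroup[OF normal_lower_central]])
  then have "a \<in> lower_central G 3"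
    using commutator_in_commutator_subgroup[of "a [^] m" "lower_central G 2" t "carrier G"] t comm
    by (simp add: numerals)
  \<comment> \<open>The normal subgroup chosen is \<open>\<gamma>\<^sub>3\<close> itself.\<close>
  from commutator_subgroup_subset_normal[OF normal_lower_central this t gen]
  show "lower_central G 2 \<subseteq> lower_central G 3"
    by (simp add: numerals)
  show "lower_central G 3 \<subseteq> lower_central G 2"
    using lower_central_antimono_Suc[of 2] by simp
qed

end

text \<open>A commutator maps to a commutator, which is trivial in an abelian group. This supplies
  the obstruction to \<open>\<gamma>\<^sub>2\<close> being the whole group.\<close>

lemma (in group_hom) commutator_subgroup_subset_kernel:
  assumes "comm_group H"
  shows "commutator_subgroup G (carrier G) (carrier G) \<subseteq> kernel G H h"
proof (rule G.commutator_subgroup_subset[OF _ _ normal_kernel])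
  interpret H: comm_group H by fact
  fix x y assume xy: "x \<in> carrier G" "y \<in> carrier G"
  have "h (inv\<^bsub>G\<^esub> x \<otimes>\<^bsub>G\<^esub> inv\<^bsub>G\<^esub> y \<otimes>\<^bsub>G\<^esub> x \<otimes>\<^bsub>G\<^esub> y)
      = inv\<^bsub>H\<^esub> (h x \<otimes>\<^bsub>H\<^esub> h y) \<otimes>\<^bsub>H\<^esub> (h x \<otimes>\<^bsub>H\<^esub> h y)"
    using xy by (simp add: H.m_assoc H.inv_mult)
  then show "inv\<^bsub>G\<^esub> x \<otimes>\<^bsub>G\<^esub> inv\<^bsub>G\<^esub> y \<otimes>\<^bsub>G\<^esub> x \<otimes>\<^bsub>G\<^esub> y \<in> kernel G H h"
    using xy by (simp add: kernel_def)
qed auto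

section \<open>Baumslag-Solitar groups\<close>

text \<open>Collects what the main argument uses of the presentation: two generators, their
  relation, and a homomorphism to the integers detecting \<open>t\<close>.\<close>

lemma BS_structure:
  fixes m n :: int
  obtains a t where "a \<in> carrier (BS m n)" "t \<in> carrier (BS m n)"
    "carrier (BS m n) = generate (BS m n) {a, t}"
    "inv\<^bsub>BS m n\<^esub> t \<otimes>\<^bsub>BS m n\<^esub> a [^]\<^bsub>BS m n\<^esub> m \<otimes>\<^bsub>BS m n\<^esub> t = a [^]\<^bsub>BS m n\<^esub> n"
    "\<exists>h \<in> hom (BS m n) integer_group. h t = 1"
proof -
  define S where "S = {Gen_a, Gen_t}"
  let ?F = "free_group S"
  define a where "a = free_gen S Gen_a"
  define t where "t = free_gen S Gen_t"
  define E where "E = {(inv\<^bsub>?F\<^esub> t \<otimes>\<^bsub>?F\<^esub> a [^]\<^bsub>?F\<^esub> m \<otimes>\<^bsub>?F\<^esub> t, a [^]\<^bsub>?F\<^esub> n)}"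
  interpret F: group ?F by (rule group_free_group)
  have at: "a \<in> carrier ?F" "t \<in> carrier ?F"
    by (simp_all add: a_def t_def S_def free_gen_closed)
  interpret presentation S E
    by unfold_locales (use at in \<open>simp add: E_def\<close>)
  have BS: "BS m n = presented_group S E"
    by (simp add: BS_def Let_def E_def a_def t_def S_def)
  interpret Z: group integer_group by simp
  \<comment> \<open>On words, \<open>h\<close> is the exponent sum of \<open>t\<close>.\<close>
  obtain h where h: "h \<in> hom ?F integer_group" "h a = 0" "h t = 1"
  proof (rule Z.free_group_universal[of "\<lambda>x. if x = Gen_t then 1 else 0" S])
    fix h assume "h \<in> hom ?F integer_group"
      "\<And>x. x \<in> S \<Longrightarrow> h (free_gen S x) = (if x = Gen_t then 1 else 0)"
    then show thesis
      by (intro that[of h]) (simp_all add: a_def t_def S_def)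
  qed simp
  interpret h: group_hom ?F integer_group h
    by unfold_locales (rule h)
  \<comment> \<open>Both sides of the relation have exponent sum 0 in \<open>t\<close>: on the left,
    \<open>t\<close> and its inverse cancel. Hence \<open>h\<close> descends to the
    quotient.\<close>
  have "h u = h v" if "(u, v) \<in> E" for u v
    using that at h(2,3) by (auto simp: E_def h.hom_int_pow)
  then obtain g where "g \<in> hom (presented_group S E) integer_group"
    "\<And>A. A \<in> carrier ?F \<Longrightarrow> g (proj A) = h A"
    using universal[OF Z.is_group h(1)] by blast
  moreover have "carrier (presented_group S E) = generate (presented_group S E) {proj a, proj t}"
    using presented_group_generated by (simp add: a_def t_def S_def)
  moreover have "(inv\<^bsub>?F\<^esub> t \<otimes>\<^bsub>?F\<^esub> a [^]\<^bsub>?F\<^esub> m \<otimes>\<^bsub>?F\<^esub> t, a [^]\<^bsub>?F\<^esub> n) \<in> E"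
    by (simp add: E_def)
  then have "inv\<^bsub>presented_group S E\<^esub> proj t \<otimes>\<^bsub>presented_group S E\<^esub>
      proj a [^]\<^bsub>presented_group S E\<^esub> m \<otimes>\<^bsub>presented_group S E\<^esub> proj t
      = proj a [^]\<^bsub>presented_group S E\<^esub> n"
    using proj_relation at by (fastforce simp: proj.hom_int_pow)
  ultimately show ?thesis
    using that[of "proj a" "proj t"] at h(3) proj.hom_closed unfolding BS by metis
qed

theorem proposition3:
  fixes m :: int
  assumes "m > 1"
  shows "lower_central_length (BS m (m + 1)) 2"
proof -
  let ?G = "BS m (m + 1)"
  interpret G: group ?G by (rule group_BS)
  obtain a t h where at: "a \<in> carrier ?G" "t \<in> carrier ?G" "carrier ?G = generate ?G {a, t}"
    "inv\<^bsub>?G\<^esub> t \<otimes>\<^bsub>?G\<^esub> a [^]\<^bsub>?G\<^esub> m \<otimes>\<^bsub>?G\<^esub> t = a [^]\<^bsub>?G\<^esub> (m + 1)"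
    and h: "h \<in> hom ?G integer_group" "h t = 1"
    using BS_structure[of m "m + 1"] by metis
  interpret h: group_hom ?G integer_group h
    unfolding group_hom_def group_hom_axioms_def using h G.is_group by simp
  \<comment> \<open>The map \<open>h\<close> kills \<open>\<gamma>\<^sub>2\<close>, whereas
    \<open>h t = 1\<close> is not the neutral element 0.\<close>
  have "t \<notin> lower_central ?G 2"
    using h.commutator_subgroup_subset_kernel[OF abelian_integer_group] h(2)
    by (auto simp: numeral_2_eq_2 kernel_def)
  with at(2) have "lower_central ?G 1 \<noteq> lower_central ?G 2"
    by auto
  \<comment> \<open>Minimality only requires ruling out stabilisation at index 1.\<close>
  then have "2 \<le> M" if "1 \<le> M" "lower_central ?G M = lower_central ?G (M + 1)" for M
    using that by (cases "M = 1") (auto simp: numeral_2_eq_2)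
  then show ?thesis
    using G.lower_central_2_eq_3[OF at] by (simp add: lower_central_length_def)
qed

end
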